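(* Let $p\in R=A[t;\sigma,\delta]$ be monic of degree $n>1$, with companion matrix $C(p)\in M_n(A)$, and regard $R\subseteq M_n(A)[t;\sigma,\delta]$. The following are equivalent: (i) $t\in\mathrm{Idl}(Rp)$, i.e. $pt\in Rp$; (ii) for every $f\in R$: $f\in Rp$ if and only if $f(C(p))=0$; (iii) $p(C(p))=0$.
   Context: $A$ is a ring with $1$, $\sigma$ a unital ring endomorphism, $\delta$ a $\sigma$-derivation ($\delta$ additive, $\delta(ab)=\sigma(a)\delta(b)+\delta(a)b$); $R=A[t;\sigma,\delta]$ is the Ore extension with $ta=\sigma(a)t+\delta(a)$. $\sigma$ and $\delta$ are extended entrywise to $M_n(A)$, giving an endomorphism and a $\sigma$-derivation of $M_n(A)$, and $M_n(A)[t;\sigma,\delta]$ is the corresponding Ore extension; $A$ is embedded in $M_n(A)$ as scalar matrices, so $R\subseteq M_n(A)[t;\sigma,\delta]$. For a ring $S$ with $\sigma,\delta$, $f\in S[t;\sigma,\delta]$ and $c\in S$, $f(c)$ is the unique element of $S$ with $f-f(c)\in S[t;\sigma,\delta](t-c)$. For monic $p=t^n+a_{n-1}t^{n-1}+\dots+a_0$, $C(p)$ is its companion matrix (ones on the superdiagonal, last row $(-a_0,\dots,-a_{n-1})$, zeros elsewhere). $\mathrm{Idl}(Rp)=\{g\in R\mid pg\in Rp\}$. *)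

theory Defs
  imports "HOL-Analysis.Finite_Cartesian_Product" "HOL-Computational_Algebra.Polynomial"
begin

text \<open>Ore extensions S[t;sigma,delta] over a ring S whose multiplication is passed
explicitly as mul (so that both A, with its own product, and M_n(A) = 'a^'n^'n, with
matrix product, can be used).  An element sum_i a_i t^i is represented by the
coefficient polynomial with coeff i = a_i (the type 'a poly is only used as a
container for coefficients; its own multiplication is never used).\<close>

text \<open>Left multiplication by t: t * (c t^k) = sigma(c) t^(k+1) + delta(c) t^k.\<close>
definition ore_tmul :: "('a::comm_monoid_add \<Rightarrow> 'a) \<Rightarrow> ('a \<Rightarrow> 'a) \<Rightarrow> 'a poly \<Rightarrow> 'a poly" where
  "ore_tmul \<sigma> \<delta> h = pCons 0 (map_poly \<sigma> h) + map_poly \<delta> h"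

text \<open>Ore product: (sum a_i t^i)(sum b_j t^j) = sum_{i,j} a_i (t^i b_j) t^j.\<close>
definition ore_mult :: "('a::comm_monoid_add \<Rightarrow> 'a \<Rightarrow> 'a) \<Rightarrow> ('a \<Rightarrow> 'a) \<Rightarrow> ('a \<Rightarrow> 'a)
    \<Rightarrow> 'a poly \<Rightarrow> 'a poly \<Rightarrow> 'a poly" where
  "ore_mult mul \<sigma> \<delta> f g =
     (\<Sum>i\<le>degree f. \<Sum>j\<le>degree g.
        map_poly (mul (coeff f i)) ((pCons 0 ^^ j) ((ore_tmul \<sigma> \<delta> ^^ i) [:coeff g j:])))"

text \<open>Left ideal S[t] p.\<close>
definition ore_left_ideal :: "('a::comm_monoid_add \<Rightarrow> 'a \<Rightarrow> 'a) \<Rightarrow> ('a \<Rightarrow> 'a) \<Rightarrow> ('a \<Rightarrow> 'a)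
    \<Rightarrow> 'a poly \<Rightarrow> 'a poly set" where
  "ore_left_ideal mul \<sigma> \<delta> p = {ore_mult mul \<sigma> \<delta> q p | q. True}"

text \<open>Idealizer Idl(Rp) = {g. p g \<in> Rp}.\<close>
definition ore_Idl :: "('a::comm_monoid_add \<Rightarrow> 'a \<Rightarrow> 'a) \<Rightarrow> ('a \<Rightarrow> 'a) \<Rightarrow> ('a \<Rightarrow> 'a)
    \<Rightarrow> 'a poly \<Rightarrow> 'a poly set" where
  "ore_Idl mul \<sigma> \<delta> p = {g. ore_mult mul \<sigma> \<delta> p g \<in> ore_left_ideal mul \<sigma> \<delta> p}"

text \<open>Evaluation f(c): the unique r in S with f - r \<in> S[t;sigma,delta](t - c).\<close>
definition ore_eval :: "('a::ab_group_add \<Rightarrow> 'a \<Rightarrow> 'a) \<Rightarrow> 'a \<Rightarrow> ('a \<Rightarrow> 'a) \<Rightarrow> ('a \<Rightarrow> 'a)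
    \<Rightarrow> 'a poly \<Rightarrow> 'a \<Rightarrow> 'a" where
  "ore_eval mul one \<sigma> \<delta> f c =
     (THE r. \<exists>q. f - [:r:] = ore_mult mul \<sigma> \<delta> q [:- c, one:])"

text \<open>Entrywise extension of a map to square matrices.\<close>
definition entrywise :: "('a \<Rightarrow> 'a) \<Rightarrow> 'a^'n::finite^'n \<Rightarrow> 'a^'n^'n" where
  "entrywise g X = (\<chi> i j. g (X $ i $ j))"

text \<open>Position (0-based) of an index in the linearly ordered finite index type.\<close>
definition idx :: "'n::{finite,linorder} \<Rightarrow> nat" where
  "idx i = card {j. j < i}"

text \<open>Companion matrix: ones on the superdiagonal, last row (-a_0,...,-a_{n-1}).\<close>
definition companion :: "'a::ring_1 poly \<Rightarrow> 'a^('n::{finite,linorder})^('n::{finite,linorder})" where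
  "companion p = (\<chi> i j.
     if idx i + 1 < card (UNIV :: 'n::{finite,linorder} set) then (if idx j = idx i + 1 then 1 else 0)
     else - coeff p (idx j))"

end

theory Submission imports Defs begin

(* Lam-Leroy style evaluation of Ore polynomials at the companion matrix.

   Let R = A[t;sigma,delta] and let p be monic of degree n.  For an element c of a ring S
   with (sigma,delta), evaluation at c is computed by the "Lam-Leroy powers"
   N_0(c) = 1, N_{i+1}(c) = sigma(N_i(c)) c + delta(N_i(c)), via f(c) = sum_i a_i N_i(c).
   For the companion matrix C = C(p), the k-th row of N_i(C), read as a polynomial of
   degree < n, is congruent to t^i t^k modulo Rp.  Consequently the k-th row of f(C) is
   the remainder of f t^k modulo Rp, and
        f(C) = 0  <->  f t^k \<in> Rp for all k < n.                     (key lemma)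
   The corollary follows: (i) pt \<in> Rp gives p t^k \<in> Rp for all k, so Rp is exactly the
   set of f with f(C) = 0; (ii) implies (iii) as p \<in> Rp; and (iii) is the key lemma for
   f = p, k = 1.

   Since matrix multiplication on 'a^'n^'n is not the type-class product, the algebra
   of Ore extensions is developed in a locale with an explicit multiplication, and then
   instantiated both for A (a ring_1) and for M_n(A). *)

section \<open>Ore extensions over a ring with explicit multiplication\<close>

locale ore_ring =
  fixes mul :: "'a::ab_group_add \<Rightarrow> 'a \<Rightarrow> 'a" and one :: 'a and \<sigma> \<delta> :: "'a \<Rightarrow> 'a"
  assumes mul_assoc: "mul a (mul b c) = mul (mul a b) c"
    and mul_one_left: "mul one a = a" and mul_one_right: "mul a one = a"
    and distrib_left: "mul a (b + c) = mul a b + mul a c"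
    and distrib_right: "mul (a + b) c = mul a c + mul b c"
    and one_neq_zero: "one \<noteq> 0"
    and sigma_add: "\<sigma> (a + b) = \<sigma> a + \<sigma> b"
    and sigma_mul: "\<sigma> (mul a b) = mul (\<sigma> a) (\<sigma> b)"
    and sigma_one: "\<sigma> one = one"
    and delta_add: "\<delta> (a + b) = \<delta> a + \<delta> b"
    and delta_mul: "\<delta> (mul a b) = mul (\<sigma> a) (\<delta> b) + mul (\<delta> a) b"
begin

text \<open>Additivity of the basic operations yields their behaviour on 0, negation,
  differences and finite sums.\<close>

sublocale mul_left: additive "mul a" for a by unfold_locales (rule distrib_left)
sublocale mul_right: additive "\<lambda>b. mul b c" for c by unfold_locales (rule distrib_right)
sublocale sigma: additive \<sigma> by unfold_locales (rule sigma_add)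
sublocale delta: additive \<delta> by unfold_locales (rule delta_add)

declare mul_left.zero [simp] mul_right.zero [simp] sigma.zero [simp] delta.zero [simp]

lemma delta_one [simp]: "\<delta> one = 0"
  using delta_mul[of one one] by (simp add: mul_one_left mul_one_right sigma_one)

subsection \<open>Scalars, left multiplication by t, and the Ore product\<close>

text \<open>Left multiplication of every coefficient by a scalar, i.e. product with a constant.\<close>
definition lscale :: "'a \<Rightarrow> 'a poly \<Rightarrow> 'a poly" where
  "lscale a h = map_poly (mul a) h"

abbreviation tmul where "tmul \<equiv> ore_tmul \<sigma> \<delta>"
abbreviation omul where "omul \<equiv> ore_mult mul \<sigma> \<delta>"
abbreviation lideal where "lideal \<equiv> ore_left_ideal mul \<sigma> \<delta>"

lemma coeff_lscale [simp]: "coeff (lscale a h) k = mul a (coeff h k)"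
  by (simp add: lscale_def coeff_map_poly)

lemma coeff_tmul:
  "coeff (tmul h) k = (case k of 0 \<Rightarrow> 0 | Suc k' \<Rightarrow> \<sigma> (coeff h k')) + \<delta> (coeff h k)"
  by (simp add: ore_tmul_def coeff_map_poly coeff_pCons split: nat.splits)

sublocale tmul: additive tmul
  by unfold_locales (rule poly_eqI, simp add: coeff_tmul sigma_add delta_add split: nat.splits)

sublocale tmul_iter: additive "tmul ^^ i" for i
  by unfold_locales (induction i, auto simp: tmul.add)

sublocale lscale: additive "lscale a" for a
  by unfold_locales (rule poly_eqI, simp add: distrib_left)

sublocale lscale_scalar: additive "\<lambda>a. lscale a h" for h
  by unfold_locales (rule poly_eqI, simp add: distrib_right)

declare tmul_iter.zero [simp] lscale.zero [simp] lscale_scalar.zero [simp]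

text \<open>Left multiplication by t commutes with the coefficient shift (right multiplication
  by t), and acts on scalars by t a = sigma(a) t + delta(a).\<close>

lemma tmul_shift: "tmul (pCons 0 h) = pCons 0 (tmul h)"
  by (rule poly_eqI) (simp add: coeff_tmul coeff_pCons split: nat.splits)

lemma tmul_iter_shift: "(tmul ^^ i) ((pCons 0 ^^ j) h) = (pCons 0 ^^ j) ((tmul ^^ i) h)"
proof -
  have "(tmul ^^ i) (pCons 0 h) = pCons 0 ((tmul ^^ i) h)" for h
    by (induction i) (auto simp: tmul_shift)
  then show ?thesis by (induction j) auto
qed

lemma shift_const: "(pCons 0 ^^ j) [:a:] = monom a j"
  by (induction j) (auto simp: monom_Suc monom_0)

lemma lscale_lscale: "lscale a (lscale b h) = lscale (mul a b) h"
  by (rule poly_eqI) (simp add: mul_assoc)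

lemma lscale_pCons: "lscale a (pCons b h) = pCons (mul a b) (lscale a h)"
  by (rule poly_eqI) (simp add: coeff_pCons split: nat.splits)

lemma lscale_monom: "lscale a (monom b k) = monom (mul a b) k"
  by (rule poly_eqI) (simp add: coeff_monom)

lemma tmul_lscale: "tmul (lscale a h) = lscale (\<sigma> a) (tmul h) + lscale (\<delta> a) h"
  by (rule poly_eqI)
    (simp add: coeff_tmul sigma_mul delta_mul distrib_left add.assoc split: nat.splits)

lemma tmul_const: "tmul [:a:] = [:\<delta> a, \<sigma> a:]"
  by (rule poly_eqI) (simp add: coeff_tmul coeff_pCons split: nat.splits)

lemma tmul_monom: "tmul (monom a k) = monom (\<sigma> a) (Suc k) + monom (\<delta> a) k"
  by (rule poly_eqI) (auto simp: coeff_tmul coeff_monom split: nat.splits)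

text \<open>The Ore product f g is the sum of a_i (t^i g) over the coefficients a_i of f; the sum
  may run over any range beyond which the coefficients of f vanish.\<close>

lemma omul_expand_degree: "omul f g = (\<Sum>i\<le>degree f. lscale (coeff f i) ((tmul ^^ i) g))"
proof -
  have "(\<Sum>j\<le>degree g. map_poly (mul (coeff f i)) ((pCons 0 ^^ j) ((tmul ^^ i) [:coeff g j:])))
      = lscale (coeff f i) ((tmul ^^ i) (\<Sum>j\<le>degree g. monom (coeff g j) j))" for i
    unfolding lscale_def[symmetric] tmul_iter_shift[symmetric] shift_const[symmetric]
    by (simp only: lscale.sum tmul_iter.sum)
  then show ?thesis by (simp add: ore_mult_def poly_as_sum_of_monoms)
qed

lemma omul_expand:
  assumes "\<And>i. m \<le> i \<Longrightarrow> coeff f i = 0"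
  shows "omul f g = (\<Sum>i<m. lscale (coeff f i) ((tmul ^^ i) g))"
proof -
  let ?s = "\<lambda>i. lscale (coeff f i) ((tmul ^^ i) g)"
  let ?U = "{..<Suc (degree f) + m}"
  have "sum ?s {..degree f} = sum ?s ?U"
    by (rule sum.mono_neutral_left) (auto simp: coeff_eq_0)
  also have "\<dots> = sum ?s {..<m}"
    by (rule sum.mono_neutral_right) (auto simp: assms)
  finally show ?thesis by (simp add: omul_expand_degree)
qed

lemma omul_expand_less: "degree f < m \<Longrightarrow> omul f g = (\<Sum>i<m. lscale (coeff f i) ((tmul ^^ i) g))"
  by (rule omul_expand) (simp add: coeff_eq_0)

subsection \<open>The Ore product is additive, associative and unital\<close>

sublocale omul_left: additive "\<lambda>f. omul f g" for g
proof
  fix f f' :: "'a poly"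
  define m where "m = Suc (max (degree f) (degree f'))"
  have "degree (f + f') < m" "degree f < m" "degree f' < m"
    using degree_add_le_max[of f f'] by (auto simp: m_def)
  then show "omul (f + f') g = omul f g + omul f' g"
    by (simp add: omul_expand_less[of _ m] lscale_scalar.add sum.distrib)
qed

declare omul_left.zero [simp]

lemma omul_lscale_left: "omul (lscale a f) g = lscale a (omul f g)"
proof -
  have "omul (lscale a f) g = (\<Sum>i<Suc (degree f). lscale (coeff (lscale a f) i) ((tmul ^^ i) g))"
    by (rule omul_expand) (metis coeff_lscale coeff_eq_0 Suc_le_eq mul_left.zero)
  then show ?thesis
    by (simp only: omul_expand_degree lessThan_Suc_atMost coeff_lscale lscale.sum lscale_lscale)
qed

text \<open>(t f) g = t (f g); the heart of associativity.\<close>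
lemma omul_tmul_left: "omul (tmul f) g = tmul (omul f g)"
proof -
  define m where "m = Suc (degree f)"
  have f_vanish: "\<And>i. m \<le> i \<Longrightarrow> coeff f i = 0" by (simp add: m_def coeff_eq_0)
  then have tf_vanish: "\<And>i. Suc m \<le> i \<Longrightarrow> coeff (tmul f) i = 0"
    by (auto simp: coeff_tmul split: nat.splits)
  have "omul (tmul f) g
      = (\<Sum>i<Suc m. lscale (case i of 0 \<Rightarrow> 0 | Suc k \<Rightarrow> \<sigma> (coeff f k)) ((tmul ^^ i) g))
        + (\<Sum>i<Suc m. lscale (\<delta> (coeff f i)) ((tmul ^^ i) g))"
    by (simp add: omul_expand[OF tf_vanish] coeff_tmul lscale_scalar.add sum.distrib)
  also have "(\<Sum>i<Suc m. lscale (case i of 0 \<Rightarrow> 0 | Suc k \<Rightarrow> \<sigma> (coeff f k)) ((tmul ^^ i) g))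
      = (\<Sum>i<m. lscale (\<sigma> (coeff f i)) ((tmul ^^ Suc i) g))"
    by (subst sum.lessThan_Suc_shift) simp
  also have "(\<Sum>i<Suc m. lscale (\<delta> (coeff f i)) ((tmul ^^ i) g))
      = (\<Sum>i<m. lscale (\<delta> (coeff f i)) ((tmul ^^ i) g))"
    by (simp add: f_vanish)
  also have "(\<Sum>i<m. lscale (\<sigma> (coeff f i)) ((tmul ^^ Suc i) g))
        + (\<Sum>i<m. lscale (\<delta> (coeff f i)) ((tmul ^^ i) g))
      = tmul (\<Sum>i<m. lscale (coeff f i) ((tmul ^^ i) g))"
    by (simp add: tmul.sum tmul_lscale sum.distrib)
  finally show ?thesis by (simp add: omul_expand[OF f_vanish])
qed

lemma omul_assoc: "omul (omul f g) h = omul f (omul g h)"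
proof -
  have tmul_iter_left: "omul ((tmul ^^ i) g) h = (tmul ^^ i) (omul g h)" for i
    by (induction i) (auto simp: omul_tmul_left)
  have "omul (omul f g) h = (\<Sum>i\<le>degree f. omul (lscale (coeff f i) ((tmul ^^ i) g)) h)"
    by (simp only: omul_expand_degree[of f g] omul_left.sum)
  also have "\<dots> = (\<Sum>i\<le>degree f. lscale (coeff f i) ((tmul ^^ i) (omul g h)))"
    by (simp add: omul_lscale_left tmul_iter_left)
  also have "\<dots> = omul f (omul g h)"
    by (simp only: omul_expand_degree[of f "omul g h"])
  finally show ?thesis .
qed

lemma omul_const_left: "omul [:a:] h = lscale a h"
  by (simp add: omul_expand_degree)

lemma tmul_iter_one: "(tmul ^^ i) [:one:] = monom one i"
proof (induction i)
  case (Suc i)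
  have "(tmul ^^ Suc i) [:one:] = (tmul ^^ i) ((pCons 0 ^^ 1) [:one:])"
    by (simp only: funpow_Suc_right comp_apply) (simp add: tmul_const sigma_one)
  also have "\<dots> = pCons 0 (monom one i)"
    by (simp only: tmul_iter_shift Suc) simp
  finally show ?case by (simp add: monom_Suc)
qed (simp add: monom_0)

lemma sum_lscale_monom: "(\<Sum>i\<le>degree f. lscale (coeff f i) (monom one i)) = f"
proof (rule poly_eqI)
  fix k
  have "coeff (\<Sum>i\<le>degree f. lscale (coeff f i) (monom one i)) k
      = (\<Sum>i\<le>degree f. if i = k then coeff f i else 0)"
    by (simp add: coeff_sum mul_one_right if_distrib cong: if_cong)
  also have "\<dots> = coeff f k" by (auto simp: coeff_eq_0)
  finally show "coeff (\<Sum>i\<le>degree f. lscale (coeff f i) (monom one i)) k = coeff f k" .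
qed

lemma omul_one_right: "omul f [:one:] = f"
  by (simp add: omul_expand_degree tmul_iter_one sum_lscale_monom)

text \<open>Right multiplication by t is the shift of coefficients.\<close>
lemma omul_t_right: "omul f [:0, one:] = pCons 0 f"
proof -
  have "additive (pCons (0::'a))" by unfold_locales simp
  note shift_sum = additive.sum[OF this]
  have "(tmul ^^ i) [:0, one:] = pCons 0 (monom one i)" for i
    using tmul_iter_shift[of i 1 "[:one:]"] by (simp add: tmul_iter_one)
  then have "omul f [:0, one:] = pCons 0 (\<Sum>i\<le>degree f. lscale (coeff f i) (monom one i))"
    by (simp add: omul_expand_degree shift_sum lscale_pCons)
  then show ?thesis by (simp only: sum_lscale_monom)
qed

subsection \<open>Left ideals\<close>

lemma lideal_iff: "x \<in> lideal h \<longleftrightarrow> (\<exists>q. x = omul q h)"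
  by (simp add: ore_left_ideal_def)

lemma lideal_self: "h \<in> lideal h"
  unfolding lideal_iff
  by (rule exI[of _ "[:one:]"]) (simp add: omul_const_left lscale_def mul_one_left map_poly_idI)

lemma lideal_add: "x \<in> lideal h \<Longrightarrow> y \<in> lideal h \<Longrightarrow> x + y \<in> lideal h"
  unfolding lideal_iff by (metis omul_left.add)

lemma lideal_diff: "x \<in> lideal h \<Longrightarrow> y \<in> lideal h \<Longrightarrow> x - y \<in> lideal h"
  unfolding lideal_iff by (metis omul_left.diff)

lemma lideal_zero: "0 \<in> lideal h"
  unfolding lideal_iff by (rule exI[of _ 0]) simp

lemma lideal_sum: "(\<And>x. x \<in> S \<Longrightarrow> F x \<in> lideal h) \<Longrightarrow> sum F S \<in> lideal h"
  by (induction S rule: infinite_finite_induct) (auto simp: lideal_add lideal_zero)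

lemma lideal_omul: "x \<in> lideal h \<Longrightarrow> omul g x \<in> lideal h"
  unfolding lideal_iff by (metis omul_assoc)

lemma lideal_lscale: "x \<in> lideal h \<Longrightarrow> lscale a x \<in> lideal h"
  using lideal_omul[of x h "[:a:]"] by (simp add: omul_const_left)

lemma lideal_tmul: "x \<in> lideal h \<Longrightarrow> tmul x \<in> lideal h"
  unfolding lideal_iff by (metis omul_tmul_left)

subsection \<open>Nonzero left multiples of a monic polynomial have large degree\<close>

text \<open>t^i h has degree deg h + i and leading coefficient sigma^i (lead_coeff h).\<close>
lemma tmul_iter_top_coeff:
  "(\<forall>k > degree h + i. coeff ((tmul ^^ i) h) k = 0)
   \<and> coeff ((tmul ^^ i) h) (degree h + i) = (\<sigma> ^^ i) (lead_coeff h)"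
  by (induction i) (auto simp: coeff_tmul coeff_eq_0 split: nat.splits)

text \<open>Multiplying on the right by a monic h preserves the leading coefficient.\<close>
lemma omul_monic_lead_coeff:
  assumes "lead_coeff h = one"
  shows "coeff (omul q h) (degree q + degree h) = lead_coeff q"
proof -
  have sigma_iter_one: "(\<sigma> ^^ i) one = one" for i by (induction i) (auto simp: sigma_one)
  have "coeff (omul q h) (degree q + degree h)
      = (\<Sum>i<degree q. mul (coeff q i) (coeff ((tmul ^^ i) h) (degree q + degree h)))
        + mul (lead_coeff q) (coeff ((tmul ^^ degree q) h) (degree h + degree q))"
    by (simp add: omul_expand_less[of q "Suc (degree q)"] coeff_sum add.commute)
  also have "(\<Sum>i<degree q. mul (coeff q i) (coeff ((tmul ^^ i) h) (degree q + degree h))) = 0"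
    using tmul_iter_top_coeff by (intro sum.neutral) auto
  finally show ?thesis
    using tmul_iter_top_coeff[of h "degree q"] assms by (simp add: sigma_iter_one mul_one_right)
qed

text \<open>Remainders modulo a monic polynomial are unique: the only element of the left ideal
  of degree below deg h is 0.\<close>
lemma lideal_degree_less_zero:
  assumes "lead_coeff h = one" "x \<in> lideal h" "degree x < degree h"
  shows "x = 0"
proof -
  obtain q where q: "x = omul q h" using assms(2) lideal_iff by auto
  show ?thesis
  proof (cases "q = 0")
    case False
    then have "coeff x (degree q + degree h) \<noteq> 0"
      using omul_monic_lead_coeff[OF assms(1)] q by simp
    then have "degree q + degree h \<le> degree x" by (rule le_degree)
    then show ?thesis using assms(3) by simp
  qed (simp add: q)
qed

subsection \<open>Evaluation via the Lam-Leroy powers\<close>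

text \<open>N_i(c): the value of t^i at c.\<close>
primrec tpow :: "'a \<Rightarrow> nat \<Rightarrow> 'a" where
  "tpow c 0 = one"
| "tpow c (Suc i) = mul (\<sigma> (tpow c i)) c + \<delta> (tpow c i)"

text \<open>t^i is congruent to the constant N_i(c) modulo the left ideal generated by t - c.\<close>
lemma tmul_iter_one_mod: "(tmul ^^ i) [:one:] - [:tpow c i:] \<in> lideal [:-c, one:]"
proof (induction i)
  case 0
  show ?case by (simp add: lideal_zero)
next
  case (Suc i)
  define a where "a = tpow c i"
  have step: "tmul [:a:] - [:tpow c (Suc i):] = omul [:\<sigma> a:] [:-c, one:]"
    by (simp add: a_def tmul_const omul_const_left lscale_pCons mul_left.minus mul_one_right)
  have "(tmul ^^ Suc i) [:one:] - [:tpow c (Suc i):]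
      = tmul ((tmul ^^ i) [:one:] - [:a:]) + (tmul [:a:] - [:tpow c (Suc i):])"
    by (simp add: tmul.diff a_def)
  also have "\<dots> \<in> lideal [:-c, one:]"
    using Suc step by (intro lideal_add lideal_tmul) (auto simp: a_def lideal_iff)
  finally show ?case .
qed

text \<open>Evaluation formula: f(c) = sum_i a_i N_i(c).\<close>
lemma ore_eval_eq:
  assumes "\<And>i. m \<le> i \<Longrightarrow> coeff f i = 0"
  shows "ore_eval mul one \<sigma> \<delta> f c = (\<Sum>i<m. mul (coeff f i) (tpow c i))"
proof -
  define r where "r = (\<Sum>i<m. mul (coeff f i) (tpow c i))"
  have const_sum: "(\<Sum>i<m. [:g i:]) = [:sum g {..<m}:]" for g :: "nat \<Rightarrow> 'a"
    by (induction m) auto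
  have "f - [:r:] = (\<Sum>i<m. lscale (coeff f i) ((tmul ^^ i) [:one:] - [:tpow c i:]))"
    using omul_one_right[of f] omul_expand[OF assms, where g = "[:one:]"]
    by (simp add: r_def lscale_pCons const_sum lscale.diff sum_subtractf)
  also have "\<dots> \<in> lideal [:-c, one:]"
    by (intro lideal_sum lideal_lscale tmul_iter_one_mod)
  finally have rem: "f - [:r:] \<in> lideal [:-c, one:]" .
  have "(THE r. \<exists>q. f - [:r:] = omul q [:- c, one:]) = r"
  proof (rule the_equality)
    show "\<exists>q. f - [:r:] = omul q [:- c, one:]" using rem lideal_iff by auto
  next
    fix r' assume "\<exists>q. f - [:r':] = omul q [:- c, one:]"
    then have "f - [:r':] \<in> lideal [:-c, one:]" using lideal_iff by auto
    from lideal_diff[OF this rem] have "[:r - r':] \<in> lideal [:-c, one:]" by simp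
    then have "[:r - r':] = 0"
      using one_neq_zero by (intro lideal_degree_less_zero[of "[:-c, one:]"]) auto
    then show "r' = r" by simp
  qed
  then show ?thesis by (simp add: ore_eval_def r_def)
qed

end

section \<open>The two instances: the scalar ring A and the matrix ring M_n(A)\<close>

text \<open>A ring_1 with a unital endomorphism sigma and a sigma-derivation delta.\<close>
lemma ore_ring_scalar:
  fixes \<sigma> \<delta> :: "'a::ring_1 \<Rightarrow> 'a"
  assumes "\<sigma> 1 = 1" "\<And>x y. \<sigma> (x + y) = \<sigma> x + \<sigma> y" "\<And>x y. \<sigma> (x * y) = \<sigma> x * \<sigma> y"
    "\<And>x y. \<delta> (x + y) = \<delta> x + \<delta> y" "\<And>x y. \<delta> (x * y) = \<sigma> x * \<delta> y + \<delta> x * y"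
  shows "ore_ring (*) (1::'a) \<sigma> \<delta>"
  by unfold_locales (auto simp: assms algebra_simps)

text \<open>Entrywise sigma and delta are an endomorphism and a sigma-derivation of M_n(A).\<close>
lemma ore_ring_matrix:
  fixes \<sigma> \<delta> :: "'a::ring_1 \<Rightarrow> 'a"
  assumes "ore_ring (*) (1::'a) \<sigma> \<delta>"
  shows "ore_ring (**) (mat 1 :: 'a^'n^'n) (entrywise \<sigma>) (entrywise \<delta>)"
proof -
  interpret A: ore_ring "(*)" "1::'a" \<sigma> \<delta> by (rule assms)
  show ?thesis
  proof unfold_locales
    fix a b c :: "'a^'n^'n"
    show "a ** (b ** c) = a ** b ** c" by (rule matrix_mul_assoc)
    show "mat 1 ** a = a" "a ** mat 1 = a" by simp_all
    show "a ** (b + c) = a ** b + a ** c" by (rule matrix_add_ldistrib)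
    show "(a + b) ** c = a ** c + b ** c"
      by (simp add: vec_eq_iff matrix_matrix_mult_def sum.distrib ring_distribs)
    have "(mat 1 :: 'a^'n^'n) $ i $ i = 1" for i by (simp add: mat_def)
    then show "mat 1 \<noteq> (0::'a^'n^'n)" by (metis zero_index zero_neq_one)
    show "entrywise \<sigma> (a + b) = entrywise \<sigma> a + entrywise \<sigma> b"
      by (simp add: vec_eq_iff entrywise_def A.sigma_add)
    show "entrywise \<sigma> (a ** b) = entrywise \<sigma> a ** entrywise \<sigma> b"
      by (simp add: vec_eq_iff entrywise_def matrix_matrix_mult_def A.sigma.sum A.sigma_mul)
    show "entrywise \<sigma> (mat 1) = mat 1"
      by (simp add: vec_eq_iff entrywise_def mat_def A.sigma_one)
    show "entrywise \<delta> (a + b) = entrywise \<delta> a + entrywise \<delta> b"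
      by (simp add: vec_eq_iff entrywise_def A.delta_add)
    show "entrywise \<delta> (a ** b) = entrywise \<sigma> a ** entrywise \<delta> b + entrywise \<delta> a ** b"
      by (simp add: vec_eq_iff entrywise_def matrix_matrix_mult_def A.delta.sum A.delta_mul sum.distrib)
  qed
qed

text \<open>Scalar matrices (the image of A in M_n(A)) act by multiplying every entry.\<close>
lemma mat_mult_entry: "(mat a ** X) $ k $ j = a * X $ k $ j"
proof -
  have "(mat a ** X) $ k $ j = (\<Sum>l\<in>UNIV. (if k = l then a else 0) * X $ l $ j)"
    unfolding matrix_matrix_mult_def mat_def by simp
  also have "\<dots> = (\<Sum>l\<in>UNIV. if l = k then a * X $ l $ j else 0)" by (rule sum.cong) auto
  finally show ?thesis by simp
qed

section \<open>Positions in a finite linear order\<close>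

text \<open>idx is an order isomorphism from the index type onto {0..<n}.\<close>

lemma idx_less_card: "idx (i::'n::{finite,linorder}) < CARD('n)"
  unfolding idx_def by (rule psubset_card_mono) auto

lemma idx_inj: "inj (idx :: 'n::{finite,linorder} \<Rightarrow> nat)"
proof (rule linorder_injI)
  fix i j :: 'n assume "i < j"
  then have "idx i < idx j" unfolding idx_def by (intro psubset_card_mono) auto
  then show "idx i \<noteq> idx j" by simp
qed

lemma idx_bij: "bij_betw (idx :: 'n::{finite,linorder} \<Rightarrow> nat) UNIV {..<CARD('n)}"
proof -
  have "idx ` (UNIV::'n set) = {..<CARD('n)}"
    by (intro card_subset_eq) (auto simp: idx_less_card card_image[OF idx_inj])
  then show ?thesis using idx_inj by (simp add: bij_betw_def)
qed

lemma idx_surj: "e < CARD('n::{finite,linorder}) \<Longrightarrow> \<exists>k::'n. idx k = e"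
  using idx_bij[where 'n='n] unfolding bij_betw_def by (metis imageE lessThan_iff)

section \<open>Evaluation at the companion matrix\<close>

text \<open>A monic p of degree n over A, its companion matrix C, and evaluation f \<mapsto> f(C) of
  elements of R, regarded as elements of M_n(A)[t;sigma,delta] via scalar matrices.\<close>
locale companion_setting =
  fixes \<sigma> \<delta> :: "'a::ring_1 \<Rightarrow> 'a" and p :: "'a poly"
    and C :: "'a^('n::{finite,linorder})^('n::{finite,linorder})"
  assumes scalar_ore: "ore_ring (*) (1::'a) \<sigma> \<delta>"
    and monic: "lead_coeff p = 1" and deg: "degree p = CARD('n)"
    and C_companion: "C = companion p"
begin

sublocale A: ore_ring "(*)" "1::'a" \<sigma> \<delta> by (rule scalar_ore)
sublocale Mat: ore_ring "(**)" "mat 1 :: 'a^('n::{finite,linorder})^('n::{finite,linorder})"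
    "entrywise \<sigma>" "entrywise \<delta>"
  by (rule ore_ring_matrix[OF scalar_ore])

abbreviation eval_C :: "'a poly \<Rightarrow> 'a^('n::{finite,linorder})^('n::{finite,linorder})" where
  "eval_C f \<equiv> ore_eval (**) (mat 1) (entrywise \<sigma>) (entrywise \<delta>) (map_poly mat f) C"

text \<open>The k-th row of a matrix X, read as the polynomial sum_j X_kj t^j of degree < n.\<close>
definition row_poly :: "'a^('n::{finite,linorder})^('n::{finite,linorder}) \<Rightarrow> 'n \<Rightarrow> 'a poly" where
  "row_poly X k = (\<Sum>j\<in>UNIV. monom (X $ k $ j) (idx j))"

text \<open>The row can be read back from the coefficients, and has degree below n.\<close>
lemma coeff_row_poly_idx: "coeff (row_poly X k) (idx j) = X $ k $ j"
proof -
  have "idx j' = idx j \<longleftrightarrow> j' = j" for j' using injD[OF idx_inj] by blast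
  then show ?thesis by (simp add: row_poly_def coeff_sum coeff_monom)
qed

lemma degree_row_poly: "degree (row_poly X k) < CARD('n)"
proof -
  have "degree (monom (X $ k $ j) (idx j)) \<le> CARD('n) - 1" for j
    using idx_less_card[of j] degree_monom_le[of "X $ k $ j" "idx j"] by linarith
  then have "degree (row_poly X k) \<le> CARD('n) - 1"
    unfolding row_poly_def by (intro degree_sum_le) auto
  then show ?thesis using zero_less_card_finite[where 'a='n] by linarith
qed

text \<open>Rows of the companion matrix: t^(k+1) is congruent to the k-th row of C modulo Rp;
  for k < n - 1 they are equal, and for the last row this is t^n = -(a_0 + ... + a_(n-1) t^(n-1)).\<close>
lemma companion_row: "monom 1 (Suc (idx l)) - row_poly C l \<in> A.lideal p"
proof (cases "Suc (idx l) < CARD('n)")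
  case True
  then obtain j0 :: 'n where j0: "idx j0 = Suc (idx l)" using idx_surj by blast
  have "idx j = Suc (idx l) \<longleftrightarrow> j = j0" for j using j0 injD[OF idx_inj] by metis
  then have "row_poly C l = (\<Sum>j\<in>UNIV. if j = j0 then monom 1 (Suc (idx l)) else 0)"
    unfolding row_poly_def by (intro sum.cong) (auto simp: C_companion companion_def True j0)
  then show ?thesis by (simp add: A.lideal_zero)
next
  case False
  then have n: "Suc (idx l) = CARD('n)" using idx_less_card[of l] by simp
  have "row_poly C l = (\<Sum>j\<in>(UNIV::'n set). monom (- coeff p (idx j)) (idx j))"
    using False by (simp add: row_poly_def C_companion companion_def)
  also have "\<dots> = (\<Sum>e<CARD('n). monom (- coeff p e) e)"
    by (rule sum.reindex_bij_betw[OF idx_bij])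
  finally have row: "row_poly C l = - (\<Sum>e<CARD('n). monom (coeff p e) e)"
    by (simp add: minus_monom[symmetric] sum_negf)
  have "p = (\<Sum>e<CARD('n). monom (coeff p e) e) + monom 1 (CARD('n))"
    using monic deg poly_as_sum_of_monoms[of p] by (simp add: lessThan_Suc_atMost[symmetric])
  then have "monom 1 (Suc (idx l)) - row_poly C l = p" using row n by (simp add: add.commute)
  then show ?thesis using A.lideal_self by simp
qed

text \<open>One step of the recursion N_(i+1) = sigma(N_i) C + delta(N_i), seen on rows:
  multiplying the row polynomial by t differs from the new row by a combination of the
  companion congruences.\<close>
lemma row_poly_step:
  "A.tmul (row_poly N k) - row_poly (entrywise \<sigma> N ** C + entrywise \<delta> N) k
   = (\<Sum>l\<in>UNIV. A.lscale (\<sigma> (N $ k $ l)) (monom 1 (Suc (idx l)) - row_poly C l))"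
proof -
  have "row_poly (entrywise \<sigma> N ** C + entrywise \<delta> N) k
     = (\<Sum>j\<in>UNIV. \<Sum>l\<in>UNIV. monom (\<sigma> (N $ k $ l) * C $ l $ j) (idx j))
       + (\<Sum>j\<in>UNIV. monom (\<delta> (N $ k $ j)) (idx j))"
    by (simp add: row_poly_def matrix_matrix_mult_def entrywise_def add_monom[symmetric]
        monom_sum sum.distrib)
  also have "(\<Sum>j\<in>UNIV. \<Sum>l\<in>UNIV. monom (\<sigma> (N $ k $ l) * C $ l $ j) (idx j))
      = (\<Sum>l\<in>UNIV. \<Sum>j\<in>UNIV. monom (\<sigma> (N $ k $ l) * C $ l $ j) (idx j))"
    by (rule sum.swap)
  moreover have "A.tmul (row_poly N k) = (\<Sum>j\<in>UNIV. monom (\<sigma> (N $ k $ j)) (Suc (idx j)))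
       + (\<Sum>j\<in>UNIV. monom (\<delta> (N $ k $ j)) (idx j))"
    by (simp add: row_poly_def A.tmul.sum A.tmul_monom sum.distrib)
  ultimately show ?thesis
    by (simp add: A.lscale.diff A.lscale.sum row_poly_def A.lscale_monom sum_subtractf)
qed

text \<open>t^i t^k is congruent modulo Rp to the k-th row of N_i(C).\<close>
lemma row_poly_tpow: "(A.tmul ^^ i) (monom 1 (idx k)) - row_poly (Mat.tpow C i) k \<in> A.lideal p"
proof (induction i)
  case 0
  have "row_poly (mat 1) k = (\<Sum>j\<in>UNIV. if j = k then monom 1 (idx k) else 0)"
    unfolding row_poly_def by (intro sum.cong) (auto simp: mat_def)
  then show ?case by (simp add: A.lideal_zero)
next
  case (Suc i)
  define N where "N = Mat.tpow C i"
  have "(A.tmul ^^ Suc i) (monom 1 (idx k)) - row_poly (Mat.tpow C (Suc i)) k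
     = A.tmul ((A.tmul ^^ i) (monom 1 (idx k)) - row_poly N k)
       + (A.tmul (row_poly N k) - row_poly (entrywise \<sigma> N ** C + entrywise \<delta> N) k)"
    by (simp add: N_def A.tmul.diff)
  also have "\<dots> \<in> A.lideal p"
    unfolding row_poly_step using Suc
    by (intro A.lideal_add A.lideal_tmul A.lideal_sum A.lideal_lscale companion_row)
      (simp_all add: N_def)
  finally show ?case .
qed

text \<open>The k-th row of f(C) is the remainder of f t^k modulo Rp.\<close>
lemma row_poly_eval: "A.omul f (monom 1 (idx k)) - row_poly (eval_C f) k \<in> A.lideal p"
proof -
  have "\<And>i. Suc (degree f) \<le> i
      \<Longrightarrow> coeff (map_poly mat f :: ('a^('n::{finite,linorder})^('n::{finite,linorder})) poly) i = 0"
    by (simp add: coeff_map_poly coeff_eq_0)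
  from Mat.ore_eval_eq[OF this]
  have eval: "eval_C f = (\<Sum>i\<le>degree f. mat (coeff f i) ** Mat.tpow C i)"
    by (simp add: coeff_map_poly lessThan_Suc_atMost)
  have "row_poly (eval_C f) k
      = (\<Sum>j\<in>UNIV. \<Sum>i\<le>degree f. monom (coeff f i * Mat.tpow C i $ k $ j) (idx j))"
    by (simp add: eval row_poly_def sum_component mat_mult_entry monom_sum)
  also have "\<dots> = (\<Sum>i\<le>degree f. \<Sum>j\<in>UNIV. monom (coeff f i * Mat.tpow C i $ k $ j) (idx j))"
    by (rule sum.swap)
  also have "\<dots> = (\<Sum>i\<le>degree f. A.lscale (coeff f i) (row_poly (Mat.tpow C i) k))"
    by (simp add: row_poly_def A.lscale.sum A.lscale_monom)
  finally have "A.omul f (monom 1 (idx k)) - row_poly (eval_C f) k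
      = (\<Sum>i\<le>degree f. A.lscale (coeff f i)
           ((A.tmul ^^ i) (monom 1 (idx k)) - row_poly (Mat.tpow C i) k))"
    by (simp add: A.omul_expand_degree A.lscale.diff sum_subtractf)
  also have "\<dots> \<in> A.lideal p" by (intro A.lideal_sum A.lideal_lscale row_poly_tpow)
  finally show ?thesis .
qed

text \<open>Key lemma: f(C) = 0 iff f t^e \<in> Rp for every e < n.\<close>
lemma eval_C_zero_iff: "eval_C f = 0 \<longleftrightarrow> (\<forall>e<CARD('n). A.omul f (monom 1 e) \<in> A.lideal p)"
proof
  assume zero: "eval_C f = 0"
  show "\<forall>e<CARD('n). A.omul f (monom 1 e) \<in> A.lideal p"
  proof (intro allI impI)
    fix e assume "e < CARD('n)"
    then obtain k :: 'n where "idx k = e" using idx_surj by blast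
    moreover have "row_poly 0 k = 0" by (simp add: row_poly_def)
    ultimately show "A.omul f (monom 1 e) \<in> A.lideal p" using row_poly_eval[of f k] zero by simp
  qed
next
  assume multiples: "\<forall>e<CARD('n). A.omul f (monom 1 e) \<in> A.lideal p"
  have "row_poly (eval_C f) k = 0" for k
  proof (rule A.lideal_degree_less_zero[OF monic])
    have "A.omul f (monom 1 (idx k)) \<in> A.lideal p" using multiples idx_less_card by blast
    from A.lideal_diff[OF this row_poly_eval[of f k]]
    show "row_poly (eval_C f) k \<in> A.lideal p" by simp
    show "degree (row_poly (eval_C f) k) < degree p" using deg degree_row_poly by simp
  qed
  then show "eval_C f = 0"
    by (metis coeff_row_poly_idx coeff_0 vec_eq_iff zero_index)
qed

text \<open>If t idealizes Rp, so does every power of t.\<close>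
lemma idealizer_t_powers:
  assumes "A.omul p [:0, 1:] \<in> A.lideal p"
  shows "A.omul p (monom 1 e) \<in> A.lideal p"
proof (induction e)
  case 0
  show ?case by (simp add: monom_0 A.omul_one_right A.lideal_self)
next
  case (Suc e)
  then obtain q where q: "A.omul p (monom 1 e) = A.omul q p" using A.lideal_iff by blast
  have "monom 1 (Suc e) = A.omul (monom 1 e) [:0, 1:]"
    by (simp add: A.omul_t_right monom_Suc)
  then have "A.omul p (monom 1 (Suc e)) = A.omul q (A.omul p [:0, 1:])"
    by (simp only: A.omul_assoc[symmetric] q)
  then show ?case using A.lideal_omul[OF assms] by simp
qed

text \<open>(i) implies (ii): if t idealizes Rp, then Rp is exactly the set of f with f(C) = 0.\<close>
lemma t_idealizer_imp_lideal_eq: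
  assumes "[:0, 1:] \<in> ore_Idl (*) \<sigma> \<delta> p"
  shows "\<forall>f. f \<in> A.lideal p \<longleftrightarrow> eval_C f = 0"
proof (intro allI iffI)
  fix f assume "f \<in> A.lideal p"
  then obtain q where q: "f = A.omul q p" using A.lideal_iff by blast
  have "A.omul f (monom 1 e) \<in> A.lideal p" for e
    using A.lideal_omul[OF idealizer_t_powers[of e], of q] assms
    by (simp add: q A.omul_assoc ore_Idl_def)
  then show "eval_C f = 0" using eval_C_zero_iff by blast
next
  fix f assume "eval_C f = 0"
  then have "A.omul f (monom 1 0) \<in> A.lideal p"
    using eval_C_zero_iff zero_less_card_finite by blast
  then show "f \<in> A.lideal p" by (simp add: monom_0 A.omul_one_right)
qed

text \<open>(iii) implies (i): the key lemma for f = p and e = 1 < n.\<close>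
lemma eval_C_p_zero_imp_t_idealizer:
  assumes "CARD('n) > 1" and "eval_C p = 0"
  shows "[:0, 1:] \<in> ore_Idl (*) \<sigma> \<delta> p"
proof -
  have "A.omul p (monom 1 1) \<in> A.lideal p" using assms eval_C_zero_iff by blast
  moreover have "monom (1::'a) 1 = [:0, 1:]" by (simp add: monom_Suc monom_0)
  ultimately show ?thesis by (simp add: ore_Idl_def)
qed

end

section \<open>The corollary\<close>

theorem corollary1p12:
  fixes \<sigma> \<delta> :: "'a::ring_1 \<Rightarrow> 'a" and p :: "'a poly"
  assumes sigma_one: "\<sigma> 1 = 1"
      and sigma_add: "\<And>x y. \<sigma> (x + y) = \<sigma> x + \<sigma> y"
      and sigma_mult: "\<And>x y. \<sigma> (x * y) = \<sigma> x * \<sigma> y"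
      and delta_add: "\<And>x y. \<delta> (x + y) = \<delta> x + \<delta> y"
      and delta_mult: "\<And>x y. \<delta> (x * y) = \<sigma> x * \<delta> y + \<delta> x * y"
      and monic: "lead_coeff p = 1"
      and deg: "degree p = CARD('n::{finite,linorder})"
      and deg_gt1: "CARD('n::{finite,linorder}) > 1"
  shows "([:0, 1:] \<in> ore_Idl (*) \<sigma> \<delta> p
          \<longleftrightarrow> (\<forall>f. f \<in> ore_left_ideal (*) \<sigma> \<delta> p \<longleftrightarrow>
                 ore_eval (**) (mat 1) (entrywise \<sigma>) (entrywise \<delta>) (map_poly mat f)
                   (companion p :: 'a^('n::{finite,linorder})^('n::{finite,linorder})) = 0))
       \<and> ((\<forall>f. f \<in> ore_left_ideal (*) \<sigma> \<delta> p \<longleftrightarrow>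
                 ore_eval (**) (mat 1) (entrywise \<sigma>) (entrywise \<delta>) (map_poly mat f)
                   (companion p :: 'a^('n::{finite,linorder})^('n::{finite,linorder})) = 0)
          \<longleftrightarrow> ore_eval (**) (mat 1) (entrywise \<sigma>) (entrywise \<delta>) (map_poly mat p)
                   (companion p :: 'a^('n::{finite,linorder})^('n::{finite,linorder})) = 0)"
proof -
  interpret companion_setting \<sigma> \<delta> p
    "companion p :: 'a^('n::{finite,linorder})^('n::{finite,linorder})"
    using ore_ring_scalar[OF sigma_one sigma_add sigma_mult delta_add delta_mult] monic deg
    by (simp add: companion_setting_def)
  note i_imp_ii = t_idealizer_imp_lideal_eq
  have ii_imp_iii: "eval_C p = 0" if "\<forall>f. f \<in> A.lideal p \<longleftrightarrow> eval_C f = 0"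
    using that A.lideal_self by blast
  note iii_imp_i = eval_C_p_zero_imp_t_idealizer[OF deg_gt1]
  show ?thesis using i_imp_ii ii_imp_iii iii_imp_i by blast
qed

end
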